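(* Let $L>0$ and $T>0$, and let $u=u(x,t)$ be a sufficiently smooth solution of $$u_t=(uu_x)_{xx}=\tfrac12 (u^2)_{xxx}\quad\text{for } x<0,\ 0<t<T,$$ with initial data $u(x,0)=u_0(x)\le0$, $u_0\not\equiv0$, satisfying for all $t\in(0,T)$ the conditions $$u=0,\qquad (u^2)_x\ge0,\qquad (u^2)_{xx}\le0\qquad\text{at } x=0 .$$ Define $$J(t)=-\int_{-L}^0u(x,t)(x+L)^3\,dx,\qquad J_0=J(0)=-\int_{-L}^0u_0(x)(x+L)^3\,dx,$$ and assume $J_0>0$. Then $$J'(t)\ge\frac{3}{L^7}J^2(t)\quad\text{for } t\in(0,T),$$ and consequently $$J(t)\ge\frac{L^7}{3(T_0-t)},\qquad\text{where } T_0=\frac{L^7}{3J_0},$$ so that the solution blows up in finite time: its lifetime satisfies $T\le T_0$.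
   Context: "Sufficiently smooth" means that $u$ is smooth enough up to $x=0$ and $t=0$ that $J$ is continuous on $[0,T)$ and differentiable on $(0,T)$, differentiation under the integral sign is allowed, and integration by parts three times in $x$ over $[-L,0]$ is justified. *)

theory Defs
  imports "HOL-Analysis.Analysis"
begin

text \<open>
  A function of space and time is a map \<open>u :: real \<Rightarrow> real \<Rightarrow> real\<close>, written \<open>u x t\<close>; only its
  values for \<open>x \<le> 0\<close> and \<open>0 \<le> t < T\<close> matter.
\<close>

text \<open>
  The space derivative is taken within \<open>{..0}\<close>: it is the ordinary derivative for \<open>x < 0\<close>, the
  left derivative at \<open>x = 0\<close>, and is unaffected by values at positive arguments.
\<close>

definition dx :: "(real \<Rightarrow> real) \<Rightarrow> real \<Rightarrow> real" where
  "dx f x = vector_derivative f (at x within {..0})"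

definition dt :: "(real \<Rightarrow> real \<Rightarrow> real) \<Rightarrow> real \<Rightarrow> real \<Rightarrow> real" where
  "dt u x t = deriv (\<lambda>s. u x s) t"

definition sq :: "(real \<Rightarrow> real \<Rightarrow> real) \<Rightarrow> real \<Rightarrow> real \<Rightarrow> real" where
  "sq u t = (\<lambda>x. (u x t)\<^sup>2)"

definition flux :: "(real \<Rightarrow> real \<Rightarrow> real) \<Rightarrow> real \<Rightarrow> real \<Rightarrow> real" where
  "flux u t = (\<lambda>x. u x t * dx (\<lambda>y. u y t) x)"

text \<open>
  Classical solutions: as derivative operators are total, the existence of every derivative
  occurring in the equation is required explicitly.
\<close>

definition classical_solution :: "real \<Rightarrow> (real \<Rightarrow> real \<Rightarrow> real) \<Rightarrow> bool" where
  "classical_solution T u \<longleftrightarrow>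
    (\<forall>x<0. \<forall>t\<in>{0<..<T}.
      (\<lambda>s. u x s) differentiable (at t) \<and>
      (\<lambda>y. u y t) differentiable (at x) \<and>
      flux u t differentiable (at x) \<and>
      dx (flux u t) differentiable (at x) \<and>
      dt u x t = dx (dx (flux u t)) x \<and>
      dx (dx (flux u t)) x = 1/2 * dx (dx (dx (sq u t))) x)"

definition moment :: "real \<Rightarrow> (real \<Rightarrow> real) \<Rightarrow> real" where
  "moment L f = - integral {-L..0} (\<lambda>x. f x * (x + L) ^ 3)"

text \<open>
  The regularity used for the moment \<open>J\<close> of a solution. The first block says that \<open>J\<close> is well
  defined and continuous up to \<open>t = 0\<close>; the second that \<open>J\<close> is differentiable, with derivative
  obtained under the integral sign; the third that \<open>u\<^sup>2\<close> is regular enough in \<open>x\<close>, up to \<open>x = 0\<close>,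
  for three integrations by parts over \<open>[-L, 0]\<close>. Only \<open>u\<^sup>2\<close>, and not \<open>u\<close>, is required to have a
  derivative at \<open>x = 0\<close>, since the boundary conditions involve only derivatives of \<open>u\<^sup>2\<close>.
\<close>

definition sufficiently_smooth :: "real \<Rightarrow> real \<Rightarrow> (real \<Rightarrow> real \<Rightarrow> real) \<Rightarrow> bool" where
  "sufficiently_smooth L T u \<longleftrightarrow>
    (\<forall>t\<in>{0..<T}. (\<lambda>x. u x t * (x + L) ^ 3) integrable_on {-L..0}) \<and>
    continuous_on {0..<T} (\<lambda>t. moment L (\<lambda>x. u x t)) \<and>

    (\<forall>t\<in>{0<..<T}.
      (\<lambda>x. dt u x t * (x + L) ^ 3) integrable_on {-L..0} \<and>
      ((\<lambda>s. moment L (\<lambda>x. u x s)) has_real_derivative moment L (\<lambda>x. dt u x t)) (at t)) \<and>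

    (\<forall>t\<in>{0<..<T}.
      (\<forall>x\<in>{-L..0}. sq u t differentiable (at x within {..0})) \<and>
      (\<forall>x\<in>{-L..0}. dx (sq u t) differentiable (at x within {..0})) \<and>
      continuous_on {-L..0} (dx (dx (sq u t))) \<and>
      (\<forall>x\<in>{-L..<0}. dx (dx (sq u t)) differentiable (at x)))"

end

theory Submission
  imports Defs
begin

text \<open>
  Testing the equation against the weight \<open>(x + L)\<^sup>3\<close> turns it into an ordinary differential
  inequality for the moment \<open>J\<close>. Write \<open>v = u\<^sup>2\<close>. Three integrations by parts move all derivatives
  from \<open>v\<close> onto the weight, whose third derivative is \<open>6\<close>. The weight vanishes to third order at
  \<open>-L\<close>, so only boundary terms at \<open>x = 0\<close> appear, and
  \<open>J' = 3 \<integral> v - (L\<^sup>3 / 2) v\<^sub>x\<^sub>x(0) + (3 L\<^sup>2 / 2) v\<^sub>x(0) - 3 L v(0)\<close>.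
  The boundary conditions make the first two boundary terms nonnegative and the third one zero, so
  \<open>J' \<ge> 3 \<integral> u\<^sup>2\<close> (\<open>integral_third_derivative_cubic_weight\<close>). The Cauchy--Schwarz inequality
  bounds the right-hand side below by a multiple of \<open>J\<^sup>2\<close>, because the weight has squared norm
  \<open>L^7 / 7\<close> (\<open>moment_squared_le\<close>); this gives even \<open>J' \<ge> (21 / L^7) J\<^sup>2\<close>.

  A positive solution of \<open>J' \<ge> c J\<^sup>2\<close> increases, and \<open>1 / J\<close> falls with slope at most \<open>-c\<close>
  (\<open>riccati_reciprocal_bound\<close>). Since \<open>1 / J\<close> stays positive, time cannot pass the zero \<open>T0\<close> of the
  line \<open>1 / J0 - c t\<close>, which is also the bound on the lifetime.
\<close>

section \<open>A Riccati differential inequality\<close>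

text \<open>
  Positivity has to come first, since otherwise \<open>1 / f\<close> need not be differentiable: it holds because
  \<open>f' \<ge> c f\<^sup>2 \<ge> 0\<close> makes \<open>f\<close> nondecreasing. Then \<open>1 / f + c t\<close> has derivative
  \<open>c - f' / f\<^sup>2 \<le> 0\<close>.
\<close>

lemma riccati_reciprocal_bound:
  fixes f f' :: "real \<Rightarrow> real"
  assumes c: "c \<ge> 0"
    and cont: "continuous_on {0..<T} f"
    and deriv: "\<And>t. t \<in> {0<..<T} \<Longrightarrow> (f has_real_derivative f' t) (at t)"
    and ineq: "\<And>t. t \<in> {0<..<T} \<Longrightarrow> f' t \<ge> c * (f t)\<^sup>2"
    and pos: "f 0 > 0"
    and t: "t \<in> {0..<T}"
  shows "f t > 0" and "1 / f t \<le> 1 / f 0 - c * t"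
proof -
  have contf: "continuous_on {0..s} f" if "s < T" for s
    by (rule continuous_on_subset[OF cont]) (use that in auto)
  have ge: "f 0 \<le> f s" if s: "s \<in> {0..<T}" for s
  proof (rule DERIV_nonneg_imp_increasing_open[where f = f])
    show "0 \<le> s" using s by simp
    show "continuous_on {0..s} f" using contf s by simp
    fix r assume "0 < r" "r < s"
    then have r: "r \<in> {0<..<T}" using s by auto
    have "0 \<le> c * (f r)\<^sup>2" using c by simp
    then show "\<exists>y. (f has_real_derivative y) (at r) \<and> 0 \<le> y"
      using deriv[OF r] ineq[OF r] by (meson order_trans)
  qed
  have fpos: "f s > 0" if "s \<in> {0..<T}" for s
    using ge[OF that] pos by simp
  show "f t > 0" using fpos t by blast
  have "1 / f t + c * t \<le> 1 / f 0 + c * 0"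
  proof (rule DERIV_nonpos_imp_decreasing_open[where f = "\<lambda>t. 1 / f t + c * t"])
    show "0 \<le> t" using t by simp
    have "f s \<noteq> 0" if "s \<in> {0..t}" for s
      using fpos[of s] that t by auto
    then show "continuous_on {0..t} (\<lambda>t. 1 / f t + c * t)"
      using contf[of t] t by (intro continuous_intros) auto
    fix r assume "0 < r" "r < t"
    then have r: "r \<in> {0<..<T}" using t by auto
    have fr: "f r > 0" using fpos r by auto
    have "((\<lambda>t. 1 / f t + c * t) has_real_derivative c - f' r / (f r)\<^sup>2) (at r)"
      by (rule derivative_eq_intros deriv[OF r] refl | use fr in \<open>simp add: power2_eq_square\<close>)+
    moreover have "c - f' r / (f r)\<^sup>2 \<le> 0"
      using ineq[OF r] fr by (simp add: field_simps)
    ultimately show "\<exists>y. ((\<lambda>t. 1 / f t + c * t) has_real_derivative y) (at r) \<and> y \<le> 0"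
      by blast
  qed
  then show "1 / f t \<le> 1 / f 0 - c * t" by simp
qed

section \<open>Integrals against the cubic weight\<close>

lemma has_integral_weight_squared:
  fixes L :: real
  assumes "L > 0"
  shows "((\<lambda>x. ((x + L) ^ 3)\<^sup>2) has_integral L ^ 7 / 7) {-L..0}"
proof -
  have "((\<lambda>x. ((x + L) ^ 3)\<^sup>2) has_integral (0 + L) ^ 7 / 7 - (-L + L) ^ 7 / 7) {-L..0}"
  proof (rule fundamental_theorem_of_calculus)
    fix x :: real
    have "((\<lambda>x. (x + L) ^ 7 / 7) has_real_derivative ((x + L) ^ 3)\<^sup>2) (at x within {-L..0})"
      by (auto intro!: derivative_eq_intros simp flip: power_mult)
    then show "((\<lambda>x. (x + L) ^ 7 / 7) has_vector_derivative ((x + L) ^ 3)\<^sup>2)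
        (at x within {-L..0})"
      by (simp add: has_real_derivative_iff_has_vector_derivative)
  qed (use assms in simp)
  then show ?thesis by simp
qed

text \<open>
  The Cauchy--Schwarz inequality, from integrating \<open>(f - k (x + L)\<^sup>3)\<^sup>2 \<ge> 0\<close> with the optimal
  constant \<open>k\<close>, so that only gauge integrals of \<open>f\<^sup>2\<close> and of \<open>f\<close> times the weight occur.
\<close>

lemma moment_squared_le:
  assumes L: "L > 0"
    and f: "(\<lambda>x. f x * (x + L) ^ 3) integrable_on {-L..0}"
    and f2: "(\<lambda>x. (f x)\<^sup>2) integrable_on {-L..0}"
  shows "(moment L f)\<^sup>2 \<le> L ^ 7 / 7 * integral {-L..0} (\<lambda>x. (f x)\<^sup>2)"
proof -
  define m V where "m = moment L f" and "V = integral {-L..0} (\<lambda>x. (f x)\<^sup>2)"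
  define k where "k = - 7 * m / L ^ 7"
  have "((\<lambda>x. f x * (x + L) ^ 3) has_integral - m) {-L..0}"
    using f unfolding m_def moment_def by (simp add: integrable_integral)
  then have "((\<lambda>x. (f x)\<^sup>2 - 2 * k * (f x * (x + L) ^ 3) + k\<^sup>2 * ((x + L) ^ 3)\<^sup>2) has_integral
      V - 2 * k * (- m) + k\<^sup>2 * (L ^ 7 / 7)) {-L..0}"
    using f2 unfolding V_def
    by (intro has_integral_add has_integral_diff has_integral_mult_right
        has_integral_weight_squared[OF L] integrable_integral)
  then have "0 \<le> V - 2 * k * (- m) + k\<^sup>2 * (L ^ 7 / 7)"
  proof (rule has_integral_nonneg)
    fix x
    have "(f x)\<^sup>2 - 2 * k * (f x * (x + L) ^ 3) + k\<^sup>2 * ((x + L) ^ 3)\<^sup>2 = (f x - k * (x + L) ^ 3)\<^sup>2"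
      by (simp add: power2_diff power_mult_distrib)
    then show "0 \<le> (f x)\<^sup>2 - 2 * k * (f x * (x + L) ^ 3) + k\<^sup>2 * ((x + L) ^ 3)\<^sup>2"
      by simp
  qed
  also have "\<dots> = V - 7 * m\<^sup>2 / L ^ 7"
    using L unfolding k_def by (simp add: field_simps power2_eq_square)
  finally show ?thesis
    using L unfolding m_def V_def by (simp add: field_simps)
qed

lemma dx_has_vector_derivative:
  assumes "f differentiable (at x within {..0})"
  shows "(f has_vector_derivative dx f x) (at x within {..0})"
  using assms unfolding dx_def by (simp add: vector_derivative_works)

lemma dx_has_real_derivative:
  assumes "f differentiable (at x within {..0})" "x < 0"
  shows "(f has_real_derivative dx f x) (at x)"
proof -
  have "x \<in> interior {..0}" using assms by simp
  then have "at x within {..0} = at x" by (rule at_within_interior)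
  then show ?thesis
    using dx_has_vector_derivative[OF assms(1)]
    by (simp add: has_real_derivative_iff_has_vector_derivative)
qed

text \<open>
  The three integrations by parts are done at once: with \<open>w = x + L\<close>, the function
  \<open>v'' w\<^sup>3 - 3 v' w\<^sup>2 + 6 v w\<close> has derivative \<open>v''' w\<^sup>3 + 6 v\<close>, and it vanishes at \<open>x = -L\<close>. The
  form with interior derivatives of the fundamental theorem is what allows \<open>v''\<close> to be merely
  continuous at \<open>x = 0\<close>.
\<close>

lemma integral_third_derivative_cubic_weight:
  assumes L: "L > 0"
    and d1: "\<And>x. x \<in> {-L..0} \<Longrightarrow> v differentiable (at x within {..0})"
    and d2: "\<And>x. x \<in> {-L..0} \<Longrightarrow> dx v differentiable (at x within {..0})"
    and c2: "continuous_on {-L..0} (dx (dx v))"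
    and d3: "\<And>x. x \<in> {-L<..<0} \<Longrightarrow> dx (dx v) differentiable (at x)"
  shows "v integrable_on {-L..0}"
    and "((\<lambda>x. dx (dx (dx v)) x * (x + L) ^ 3) has_integral
        L ^ 3 * dx (dx v) 0 - 3 * L\<^sup>2 * dx v 0 + 6 * L * v 0 - 6 * integral {-L..0} v) {-L..0}"
proof -
  have sub: "continuous_on {-L..0} g"
    if "\<And>x. x \<in> {-L..0} \<Longrightarrow> g differentiable (at x within {..0})" for g :: "real \<Rightarrow> real"
  proof (rule differentiable_imp_continuous_on, unfold differentiable_on_def, rule ballI)
    fix x assume "x \<in> {-L..0}"
    then show "g differentiable (at x within {-L..0})"
      by (intro differentiable_within_subset[OF that]) auto
  qed
  have c0: "continuous_on {-L..0} v" and c1: "continuous_on {-L..0} (dx v)"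
    using sub d1 d2 by blast+
  show vi: "v integrable_on {-L..0}" by (rule integrable_continuous_real[OF c0])
  define G where
    "G x = dx (dx v) x * (x + L) ^ 3 - 3 * dx v x * (x + L)\<^sup>2 + 6 * v x * (x + L)" for x
  have "((\<lambda>x. dx (dx (dx v)) x * (x + L) ^ 3 + 6 * v x) has_integral G 0 - G (-L)) {-L..0}"
  proof (rule fundamental_theorem_of_calculus_interior)
    show "continuous_on {-L..0} G"
      unfolding G_def by (intro continuous_intros c0 c1 c2)
    fix x assume x: "x \<in> {-L<..<0}"
    have "(v has_real_derivative dx v x) (at x)"
      "(dx v has_real_derivative dx (dx v) x) (at x)"
      "(dx (dx v) has_real_derivative dx (dx (dx v)) x) (at x)"
      using x d1 d2 d3 by (auto intro!: dx_has_real_derivative intro: differentiable_at_withinI)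
    then have "(G has_real_derivative dx (dx (dx v)) x * (x + L) ^ 3 + 6 * v x) (at x)"
      unfolding G_def
      by (auto intro!: derivative_eq_intros simp: algebra_simps power2_eq_square)
    then show "(G has_vector_derivative dx (dx (dx v)) x * (x + L) ^ 3 + 6 * v x) (at x)"
      by (simp add: has_real_derivative_iff_has_vector_derivative)
  qed (use L in simp)
  from has_integral_diff[OF this has_integral_mult_right[OF integrable_integral[OF vi], of 6]]
  show "((\<lambda>x. dx (dx (dx v)) x * (x + L) ^ 3) has_integral
        L ^ 3 * dx (dx v) 0 - 3 * L\<^sup>2 * dx v 0 + 6 * L * v 0 - 6 * integral {-L..0} v) {-L..0}"
    by (simp add: G_def algebra_simps)
qed

section \<open>Blow-up of the moment\<close>

text \<open>
  The initial datum is prescribed only for \<open>x < 0\<close>, and the equation holds only there; the moment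
  does not see the endpoint.
\<close>

lemma moment_cong_neg:
  assumes "\<And>x. x \<in> {-L<..<0} \<Longrightarrow> f x = g x"
  shows "moment L f = moment L g"
proof -
  have "integral {-L..0} (\<lambda>x. f x * (x + L) ^ 3) = integral {-L..0} (\<lambda>x. g x * (x + L) ^ 3)"
    by (rule integral_spike[where S = "{-L, 0}"]) (use assms in auto)
  then show ?thesis by (simp add: moment_def)
qed

text \<open>
  The boundary terms at \<open>x = 0\<close> vanish or increase \<open>J'\<close>, so discarding them leaves
  \<open>J' \<ge> 3 \<integral> u\<^sup>2\<close>, which the Cauchy--Schwarz inequality compares with \<open>J\<^sup>2\<close>.
\<close>

lemma moment_dt_ge:
  assumes L: "L > 0"
    and smooth: "sufficiently_smooth L T u"
    and solution: "classical_solution T u"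
    and t: "t \<in> {0<..<T}"
    and bc: "u 0 t = 0" "dx (sq u t) 0 \<ge> 0" "dx (dx (sq u t)) 0 \<le> 0"
  shows "moment L (\<lambda>x. dt u x t) \<ge> 3 / L ^ 7 * (moment L (\<lambda>x. u x t))\<^sup>2"
proof -
  define V where "V = integral {-L..0} (sq u t)"
  note parts = integral_third_derivative_cubic_weight[of L "sq u t"]
  have sqi: "sq u t integrable_on {-L..0}"
    and third: "((\<lambda>x. dx (dx (dx (sq u t))) x * (x + L) ^ 3) has_integral
        L ^ 3 * dx (dx (sq u t)) 0 - 3 * L\<^sup>2 * dx (sq u t) 0 + 6 * L * sq u t 0 - 6 * V) {-L..0}"
    unfolding V_def
    using parts L smooth t unfolding sufficiently_smooth_def by auto
  have "moment L (\<lambda>x. dt u x t) = moment L (\<lambda>x. 1/2 * dx (dx (dx (sq u t))) x)"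
    using solution t unfolding classical_solution_def by (intro moment_cong_neg) auto
  also have "\<dots> = - (1/2 * integral {-L..0} (\<lambda>x. dx (dx (dx (sq u t))) x * (x + L) ^ 3))"
    unfolding moment_def by (simp add: mult.assoc)
  also have "\<dots> = 3 * V - L ^ 3 / 2 * dx (dx (sq u t)) 0 + 3 * L\<^sup>2 / 2 * dx (sq u t) 0"
    using integral_unique[OF third] bc(1) by (simp add: sq_def field_simps)
  finally have eq: "moment L (\<lambda>x. dt u x t) =
      3 * V - L ^ 3 / 2 * dx (dx (sq u t)) 0 + 3 * L\<^sup>2 / 2 * dx (sq u t) 0" .
  have "L ^ 3 / 2 * dx (dx (sq u t)) 0 \<le> 0" "3 * L\<^sup>2 / 2 * dx (sq u t) 0 \<ge> 0"
    using L bc by (simp_all add: mult_nonneg_nonpos)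
  then have ge: "moment L (\<lambda>x. dt u x t) \<ge> 3 * V"
    using eq by linarith
  have "(moment L (\<lambda>x. u x t))\<^sup>2 \<le> L ^ 7 / 7 * V"
    using moment_squared_le[OF L, of "\<lambda>x. u x t"] smooth t sqi
    unfolding sufficiently_smooth_def V_def sq_def by auto
  also have "\<dots> \<le> L ^ 7 * V"
  proof -
    have "V \<ge> 0"
      unfolding V_def using sqi by (rule integral_nonneg) (simp add: sq_def)
    then show ?thesis using L by simp
  qed
  finally have "3 / L ^ 7 * (moment L (\<lambda>x. u x t))\<^sup>2 \<le> 3 * V"
    using L by (simp add: field_simps)
  then show ?thesis using ge by linarith
qed

theorem mainTheorem4:
  fixes L T J0 T0 :: real
    and u :: "real \<Rightarrow> real \<Rightarrow> real"
    and u0 J :: "real \<Rightarrow> real"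
  assumes L_pos: "L > 0"
    and T_pos: "T > 0"
    and smooth: "sufficiently_smooth L T u"
    and solution: "classical_solution T u"
    and initial: "\<And>x. x < 0 \<Longrightarrow> u x 0 = u0 x"
    and u0_nonpos: "\<And>x. x < 0 \<Longrightarrow> u0 x \<le> 0"
    and u0_nonzero: "\<exists>x<0. u0 x \<noteq> 0"
    and bc_u: "\<And>t. t \<in> {0<..<T} \<Longrightarrow> u 0 t = 0"
    and bc_dx: "\<And>t. t \<in> {0<..<T} \<Longrightarrow> dx (sq u t) 0 \<ge> 0"
    and bc_dxx: "\<And>t. t \<in> {0<..<T} \<Longrightarrow> dx (dx (sq u t)) 0 \<le> 0"
    and J_def: "\<And>t. J t = moment L (\<lambda>x. u x t)"
    and J0_def: "J0 = moment L u0"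
    and J0_pos: "J0 > 0"
    and T0_def: "T0 = L ^ 7 / (3 * J0)"
  shows "(\<forall>t\<in>{0<..<T}. deriv J t \<ge> 3 / L ^ 7 * (J t)\<^sup>2) \<and>
         (\<forall>t\<in>{0..<T}. J t \<ge> L ^ 7 / (3 * (T0 - t))) \<and>
         T \<le> T0"
proof -
  have Jeq: "J = (\<lambda>t. moment L (\<lambda>x. u x t))" using J_def by auto
  have deriv: "(J has_real_derivative moment L (\<lambda>x. dt u x t)) (at t)" if "t \<in> {0<..<T}" for t
    using smooth that unfolding sufficiently_smooth_def Jeq by blast
  have cont: "continuous_on {0..<T} J"
    using smooth unfolding sufficiently_smooth_def Jeq by blast
  have ineq: "moment L (\<lambda>x. dt u x t) \<ge> 3 / L ^ 7 * (J t)\<^sup>2" if t: "t \<in> {0<..<T}" for t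
    unfolding Jeq
    using moment_dt_ge[OF L_pos smooth solution t bc_u[OF t] bc_dx[OF t] bc_dxx[OF t]] .
  have J_0: "J 0 = J0"
    unfolding J_def J0_def by (rule moment_cong_neg) (simp add: initial)
  have c: "3 / L ^ 7 \<ge> 0" using L_pos by simp
  have line: "1 / J 0 - 3 / L ^ 7 * t = 3 * (T0 - t) / L ^ 7" for t
    unfolding J_0 T0_def using L_pos J0_pos by (simp add: field_simps)
  have bound: "J t > 0" "1 / J t \<le> 3 * (T0 - t) / L ^ 7" if t: "t \<in> {0..<T}" for t
    using riccati_reciprocal_bound[OF c cont deriv ineq _ t] J0_pos J_0 line by simp_all
  have before: "t < T0" if "t \<in> {0..<T}" for t
  proof -
    have "0 < 3 * (T0 - t) / L ^ 7"
      using bound[OF that] by (smt (verit) divide_pos_pos)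
    then show ?thesis using L_pos by (simp add: zero_less_divide_iff)
  qed
  have "J t \<ge> L ^ 7 / (3 * (T0 - t))" if "t \<in> {0..<T}" for t
    using bound[OF that] before[OF that] L_pos by (simp add: field_simps)
  moreover have "T \<le> T0"
  proof (rule ccontr)
    assume "\<not> T \<le> T0"
    moreover have "T0 > 0" unfolding T0_def using L_pos J0_pos by simp
    ultimately show False using before[of T0] by simp
  qed
  moreover have "deriv J t \<ge> 3 / L ^ 7 * (J t)\<^sup>2" if "t \<in> {0<..<T}" for t
    using ineq[OF that] DERIV_imp_deriv[OF deriv[OF that]] by simp
  ultimately show ?thesis by blast
qed

end
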